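(* For every positive integer $n$, $PF(n,n)=\left\lceil \frac{n}{2}\right\rceil$.
   Context: A partition $\lambda=(\lambda_1\ge\cdots\ge\lambda_\ell)$ of $n$ is a finite nonincreasing sequence of positive integers with sum $n$; $\ell(\lambda)$ is its number of parts. The hook length $h_{(i,j)}(\lambda)$ of a cell $(i,j)$ of the Ferrers diagram is the number of cells consisting of the cell itself, the cells to its right in its row and the cells below it in its column. A numerical set is a subset $S\subseteq\mathbb{N}_0$ containing $0$ with finite complement; a numerical semigroup is a numerical set closed under addition. For a partition $\lambda$ let $S_\lambda=\mathbb{N}_0\setminus\{h_{(i,1)}(\lambda):1\le i\le\ell(\lambda)\}$; its Frobenius number (largest element of the complement) equals the largest hook length $h_{(1,1)}(\lambda)$. $PF(n,f)$ is the number of partitions $\lambda$ of $n$ with largest hook length $h_{(1,1)}(\lambda)=f$ such that $S_\lambda$ is a numerical semigroup. *)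

theory Defs
  imports Complex_Main
begin

definition partition_of :: "nat list \<Rightarrow> nat \<Rightarrow> bool" where
  "partition_of lam n \<longleftrightarrow>
     sorted_wrt (\<ge>) lam \<and> (\<forall>p \<in> set lam. 0 < p) \<and> sum_list lam = n"

text \<open>Cells are numbered from 1, in matrix convention: row 1 is the top row and the longest one.\<close>

definition ferrers :: "nat list \<Rightarrow> (nat \<times> nat) set" where
  "ferrers lam = {(i, j). 1 \<le> i \<and> i \<le> length lam \<and> 1 \<le> j \<and> j \<le> lam ! (i - 1)}"

definition hook :: "nat list \<Rightarrow> nat \<times> nat \<Rightarrow> (nat \<times> nat) set" where
  "hook lam c = {(i, j) \<in> ferrers lam.
     (i = fst c \<and> snd c \<le> j) \<or> (j = snd c \<and> fst c \<le> i)}"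

definition hook_length :: "nat list \<Rightarrow> nat \<times> nat \<Rightarrow> nat" where
  "hook_length lam c = card (hook lam c)"

definition numerical_set :: "nat set \<Rightarrow> bool" where
  "numerical_set S \<longleftrightarrow> 0 \<in> S \<and> finite (- S)"

definition numerical_semigroup :: "nat set \<Rightarrow> bool" where
  "numerical_semigroup S \<longleftrightarrow> numerical_set S \<and> (\<forall>x \<in> S. \<forall>y \<in> S. x + y \<in> S)"

definition partition_set :: "nat list \<Rightarrow> nat set" where
  "partition_set lam = UNIV - {hook_length lam (i, 1) | i. 1 \<le> i \<and> i \<le> length lam}"

definition PF :: "nat \<Rightarrow> nat \<Rightarrow> nat" where
  "PF n f = card {lam. partition_of lam n \<and> hook_length lam (1, 1) = f
                     \<and> numerical_semigroup (partition_set lam)}"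

lemma finite_partitions: "finite {lam. partition_of lam n}"
proof (rule finite_subset)
  have "length lam \<le> sum_list lam" if "\<forall>p \<in> set lam. 0 < p" for lam :: "nat list"
    using that by (induction lam) auto
  then show "{lam. partition_of lam n} \<subseteq> {lam. set lam \<subseteq> {..n} \<and> length lam \<le> n}"
    by (auto simp: partition_of_def dest: member_le_sum_list)
  show "finite {lam. set lam \<subseteq> {..n} \<and> length lam \<le> n}"
    by (rule finite_lists_length_le) simp
qed

end

theory Submission
  imports Defs
begin

text \<open>A partition of \<open>n\<close> with largest hook length \<open>n\<close> coincides with its principal hook, so it is
  \<open>(n - k, 1, \<dots>, 1)\<close> with \<open>k\<close> ones for some \<open>k < n\<close>. Its first column hook lengths are
  \<open>1, \<dots>, k\<close> and \<open>n\<close>, so the nonzero elements of the associated numerical set are the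
  integers above \<open>k\<close> other than \<open>n\<close>. Such a set is closed under addition iff \<open>n\<close> is not a sum
  of two integers above \<open>k\<close>, i.e. iff \<open>n < 2 (k + 1)\<close>, which leaves \<open>n div 2 \<le> k < n\<close>.\<close>

definition hook_shape :: "nat \<Rightarrow> nat \<Rightarrow> nat list" where
  "hook_shape n k = (n - k) # replicate k 1"

text \<open>All parts are positive, so column 1 meets every row: the hook is all of row
  \<open>i\<close> together with one cell from each of the \<open>length lam - i\<close> rows
  below.\<close>

lemma hook_length_first_column:
  assumes pos: "\<forall>p \<in> set lam. 0 < p" and i: "1 \<le> i" "i \<le> length lam"
  shows "hook_length lam (i, 1) = lam ! (i - 1) + (length lam - i)"
proof -
  have parts: "1 \<le> lam ! (j - 1)" if "1 \<le> j" "j \<le> length lam" for j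
    using pos that by (simp add: Suc_le_eq)
  have "hook lam (i, 1) = {i} \<times> {1..lam ! (i - 1)} \<union> {i<..length lam} \<times> {1}"
  proof (intro set_eqI)
    fix c :: "nat \<times> nat"
    obtain r s where c: "c = (r, s)"
      by (cases c)
    show "c \<in> hook lam (i, 1) \<longleftrightarrow> c \<in> {i} \<times> {1..lam ! (i - 1)} \<union> {i<..length lam} \<times> {1}"
      using i parts[of r] unfolding c hook_def ferrers_def by (cases "r = i") auto
  qed
  moreover have "card \<dots> = lam ! (i - 1) + (length lam - i)"
    by (subst card_Un_disjoint) (auto simp: card_cartesian_product)
  ultimately show ?thesis
    by (simp add: hook_length_def)
qed

lemma sum_list_eq_length_imp_replicate:
  fixes xs :: "nat list"
  assumes "\<forall>x \<in> set xs. 0 < x" "sum_list xs = length xs"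
  shows "xs = replicate (length xs) 1"
  using assms
proof (induction xs)
  case (Cons x xs)
  \<comment> \<open>This leaves no slack: with \<open>0 < x\<close>, equality of the totals forces
    \<open>x = 1\<close> and passes to \<open>xs\<close>.\<close>
  have "length xs \<le> sum_list xs"
    using Cons.prems(1) by (induction xs) auto
  with Cons show ?case by auto
qed simp

lemma partition_of_hook_shape:
  assumes "k < n"
  shows "partition_of (hook_shape n k) n"
  using assms by (auto simp: partition_of_def hook_shape_def sum_list_replicate
      sorted_wrt_iff_nth_less nth_Cons split: nat.splits)

lemma hook_length_hook_shape:
  assumes "k < n" "1 \<le> i" "i \<le> k + 1"
  shows "hook_length (hook_shape n k) (i, 1) = (if i = 1 then n else k + 2 - i)"
  using assms hook_length_first_column[of "hook_shape n k" i]
  by (auto simp: hook_shape_def nth_Cons split: nat.splits)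

lemma partition_set_hook_shape:
  assumes "k < n"
  shows "partition_set (hook_shape n k) = UNIV - insert n {1..k}"
proof -
  have "{hook_length (hook_shape n k) (i, 1) | i. 1 \<le> i \<and> i \<le> length (hook_shape n k)}
      = (\<lambda>i. hook_length (hook_shape n k) (i, 1)) ` {1..k + 1}"
    by (auto simp: hook_shape_def)
  also have "\<dots> = (\<lambda>i. if i = 1 then n else k + 2 - i) ` {1..k + 1}"
    by (rule image_cong[OF refl], rule hook_length_hook_shape[OF assms]) simp_all
  \<comment> \<open>Row 1 yields \<open>n\<close>; the rows below run through \<open>{1..k}\<close>
    in reverse.\<close>
  also have "{1..k + 1} = insert 1 {2..k + 1}"
    by auto
  also have "(\<lambda>i. if i = 1 then n else k + 2 - i) ` \<dots> = insert n ((\<lambda>i. k + 2 - i) ` {2..k + 1})"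
    by force
  also have "(\<lambda>i. k + 2 - i) ` {2..k + 1} = {1..k}"
  proof
    show "{1..k} \<subseteq> (\<lambda>i. k + 2 - i) ` {2..k + 1}"
    proof
      fix x assume "x \<in> {1..k}"
      then show "x \<in> (\<lambda>i. k + 2 - i) ` {2..k + 1}"
        by (intro image_eqI[of _ _ "k + 2 - x"]) auto
    qed
  qed auto
  finally show ?thesis
    by (simp add: partition_set_def)
qed

lemma numerical_semigroup_hook_shape:
  assumes "k < n"
  shows "numerical_semigroup (partition_set (hook_shape n k)) \<longleftrightarrow> n div 2 \<le> k"
proof
  assume "numerical_semigroup (partition_set (hook_shape n k))"
  then have closed: "x + y \<noteq> n" if "x \<notin> insert n {1..k}" "y \<notin> insert n {1..k}" for x y
    using that by (auto simp: numerical_semigroup_def partition_set_hook_shape[OF assms])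
  show "n div 2 \<le> k"
  proof (rule ccontr)
    assume "\<not> n div 2 \<le> k"
    then have "2 * k + 2 \<le> n"
      by linarith
    \<comment> \<open>The smallest candidate \<open>k + 1\<close> and its complement in
      \<open>n\<close> both lie strictly between \<open>k\<close> and \<open>n\<close>, so closure
      would put the gap \<open>n\<close> in the set.\<close>
    then have "k + 1 \<notin> insert n {1..k}" "n - (k + 1) \<notin> insert n {1..k}" "k + 1 + (n - (k + 1)) = n"
      by auto
    then show False
      using closed by blast
  qed
next
  assume "n div 2 \<le> k"
  \<comment> \<open>Nonzero elements exceed \<open>k\<close>, so two of them sum to at least
    \<open>2 * k + 2\<close>, beyond the last gap \<open>n\<close>.\<close>
  then show "numerical_semigroup (partition_set (hook_shape n k))"
    using assms
    by (auto simp: numerical_semigroup_def numerical_set_def partition_set_hook_shape Compl_Diff_eq)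
qed

text \<open>Size \<open>a + sum_list xs\<close> and corner hook \<open>a + length xs\<close> both
  equal \<open>n\<close>, so the parts after the first average 1 and hence are all 1.\<close>

lemma partition_eq_hook_shape:
  assumes "partition_of lam n" "hook_length lam (1, 1) = n" "0 < n"
  obtains k where "k < n" "lam = hook_shape n k"
proof (cases lam)
  case Nil
  with assms show ?thesis
    by (simp add: partition_of_def)
next
  case (Cons a xs)
  have pos: "\<forall>p \<in> set lam. 0 < p" and total: "a + sum_list xs = n"
    using assms(1) Cons by (auto simp: partition_of_def)
  have hook: "a + length xs = n"
    using hook_length_first_column[OF pos, of 1] assms(2) Cons by simp
  have "xs = replicate (length xs) 1"
    using sum_list_eq_length_imp_replicate[of xs] pos total hook Cons by simp
  moreover have "a = n - length xs" "length xs < n"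
    using hook pos Cons by auto
  ultimately show ?thesis
    using that[of "length xs"] Cons unfolding hook_shape_def by metis
qed

lemma PF_diagonal:
  assumes "0 < n"
  shows "PF n n = n - n div 2"
proof -
  have "{lam. partition_of lam n \<and> hook_length lam (1, 1) = n
          \<and> numerical_semigroup (partition_set lam)} = hook_shape n ` {n div 2..<n}" (is "?A = ?B")
  proof
    show "?A \<subseteq> ?B"
    proof
      fix lam assume lam: "lam \<in> ?A"
      then obtain k where "k < n" "lam = hook_shape n k"
        using partition_eq_hook_shape assms by blast
      with lam show "lam \<in> ?B"
        by (simp add: numerical_semigroup_hook_shape)
    qed
    show "?B \<subseteq> ?A"
      using partition_of_hook_shape hook_length_hook_shape[of _ n 1] numerical_semigroup_hook_shape
      by auto
  qed
  \<comment> \<open>The length of the tail recovers \<open>k\<close>.\<close>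
  moreover have "inj_on (hook_shape n) {n div 2..<n}"
    by (rule inj_onI) (metis hook_shape_def length_replicate list.inject)
  ultimately show ?thesis
    by (simp add: PF_def card_image)
qed

theorem theorem4p1:
  fixes n :: nat
  assumes "0 < n"
  shows "int (PF n n) = \<lceil>real n / 2\<rceil>"
proof -
  have "\<lceil>real n / 2\<rceil> = int (n - n div 2)"
    by (cases "even n") (auto elim!: evenE oddE simp: ceiling_eq_iff)
  with PF_diagonal[OF assms] show ?thesis
    by simp
qed

end
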